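(* Let $A=(a_{j,k})_{j,k\ge1}$ be a matrix with $a_{j,k}\ge0$ for all $j,k$ such that $$\sum_{j=1}^l\sum_{k=1}^r a_{j,k}\ \ge\ \sum_{j\in N_l}\sum_{k\in N_r} a_{j,k}$$ for all $l,r\ge1$ and all sets $N_l,N_r$ of positive integers with $|N_l|=l$, $|N_r|=r$. Let $M$ be either $A$ or its transpose $A^t$. Then: (a) Let $(E,\|\cdot\|_E)$, $(F,\|\cdot\|_F)$ be normed Riesz spaces of real sequences with property $(PS)$, with $\|x\|_F=\lim_{n\to\infty}\|P_nx\|_F$ for all $x\in F$, and suppose $M$ defines an operator from $E$ to $F$. Then $\|Mx^*\|_F\ge\|Mx\|_F$ for all $x\in E$ with $x\ge0$, and hence $\|M\|_{E,F}=\|M\|_{E,F,\downarrow}$. (b) Let $1\le p<\infty$, let $v_1\ge v_2\ge\cdots\ge0$, and let $(E,\|\cdot\|_E)$ be a normed Riesz space of real sequences with property $(PS)$. Then $\|Mx^*\|_{\ell_p(v)}\ge\|Mx\|_{\ell_p(v)}$ for all $x\in E$ with $x\ge0$, and hence $\|M\|_{E,\ell_p(v)}=\|M\|_{E,\ell_p(v),\downarrow}$.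
   Context: Decreasing means non-increasing; $x\ge0$ means $x_k\ge0$ for all $k$. For a real sequence $x$, $x^*$ denotes the decreasing rearrangement of $\{|x_k|\}$: $x_n^*$ is the $n$-th largest of the numbers $|x_k|$ counted with multiplicity, i.e. $x_n^*=\max_{|N|=n}\min_{k\in N}|x_k|$ over sets $N$ of $n$ indices; $x^*$ exists if all these maxima exist. $P_nx=(x_1,\dots,x_n,0,0,\dots)$. A normed Riesz space of real sequences is a vector space of real sequences that is a vector lattice under the coordinatewise order and operations, with a norm such that $|x|\le|y|$ coordinatewise implies $\|x\|\le\|y\|$. Such a space $F$ has property $(PS)$ if for every $x\in F$ the sequence $x^*$ exists, and whenever $y$ is a real sequence for which $y^*$ exists and $y_1^*+\cdots+y_n^*\le x_1^*+\cdots+x_n^*$ for all $n\ge1$, then $y\in F$ and $\|y\|_F\le\|x\|_F$. A matrix $M=(m_{j,k})$ acts by $(Mx)_j=\sum_{k=1}^\infty m_{j,k}x_k$. In (a), $\|M\|_{E,F}=\sup_{\|x\|_E=1}\|Mx\|_F$ and $\|M\|_{E,F,\downarrow}=\sup\{\|Mx\|_F:\|x\|_E=1,\ x\ge0,\ x\text{ decreasing}\}$. In (b), $\|y\|_{\ell_p(v)}=\left(\sum_{k=1}^\infty|y_k|^pv_k\right)^{1/p}$; for $x\ge0$, $(Mx)_j\in[0,\infty]$ and $\|Mx\|_{\ell_p(v)}\in[0,\infty]$ with $0\cdot\infty=0$; since $M\ge0$ its norm is determined by non-negative sequences, $\|M\|_{E,\ell_p(v)}=\sup\{\|Mx\|_{\ell_p(v)}:\|x\|_E=1,\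 x\ge0\}$, and $\|M\|_{E,\ell_p(v),\downarrow}$ is the same supremum restricted to decreasing $x$. All norms may be $\infty$. *)

theory Defs
  imports "HOL-Analysis.Analysis"
begin

text \<open>
  Sequences and matrices are indexed from 0: \<open>x k\<close> and \<open>M j k\<close> stand for $x_{k+1}$ and
  $m_{j+1,k+1}$, and \<open>rearr x n\<close> stands for $x^*_{n+1}$.
\<close>

definition min_values :: "(nat \<Rightarrow> real) \<Rightarrow> nat \<Rightarrow> real set" where
  "min_values x n = {Min ((\<lambda>k. \<bar>x k\<bar>) ` N) | N. finite N \<and> card N = n}"

definition has_rearr :: "(nat \<Rightarrow> real) \<Rightarrow> bool" where
  "has_rearr x \<longleftrightarrow> (\<forall>n\<ge>1. \<exists>m\<in>min_values x n. \<forall>t\<in>min_values x n. t \<le> m)"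

definition rearr :: "(nat \<Rightarrow> real) \<Rightarrow> nat \<Rightarrow> real" where
  "rearr x n = (GREATEST m. m \<in> min_values x (Suc n))"

definition trunc :: "nat \<Rightarrow> (nat \<Rightarrow> real) \<Rightarrow> nat \<Rightarrow> real" where
  "trunc n x = (\<lambda>k. if k < n then x k else 0)"

definition normed_riesz_seq_space ::
  "(nat \<Rightarrow> real) set \<Rightarrow> ((nat \<Rightarrow> real) \<Rightarrow> real) \<Rightarrow> bool" where
  "normed_riesz_seq_space E nE \<longleftrightarrow>
     (\<lambda>_. 0) \<in> E \<and>
     (\<forall>x\<in>E. \<forall>y\<in>E. (\<lambda>k. x k + y k) \<in> E) \<and>
     (\<forall>c. \<forall>x\<in>E. (\<lambda>k. c * x k) \<in> E) \<and>
     (\<forall>x\<in>E. \<forall>y\<in>E. sup x y \<in> E \<and> inf x y \<in> E) \<and>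
     (\<forall>x\<in>E. 0 \<le> nE x) \<and>
     (\<forall>x\<in>E. nE x = 0 \<longleftrightarrow> x = (\<lambda>_. 0)) \<and>
     (\<forall>c. \<forall>x\<in>E. nE (\<lambda>k. c * x k) = \<bar>c\<bar> * nE x) \<and>
     (\<forall>x\<in>E. \<forall>y\<in>E. nE (\<lambda>k. x k + y k) \<le> nE x + nE y) \<and>
     (\<forall>x\<in>E. \<forall>y\<in>E. (\<forall>k. \<bar>x k\<bar> \<le> \<bar>y k\<bar>) \<longrightarrow> nE x \<le> nE y)"

definition property_PS :: "(nat \<Rightarrow> real) set \<Rightarrow> ((nat \<Rightarrow> real) \<Rightarrow> real) \<Rightarrow> bool" where
  "property_PS F nF \<longleftrightarrow>
     (\<forall>x\<in>F. has_rearr x \<and>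
        (\<forall>y. has_rearr y \<and> (\<forall>n\<ge>1. (\<Sum>i<n. rearr y i) \<le> (\<Sum>i<n. rearr x i))
             \<longrightarrow> y \<in> F \<and> nF y \<le> nF x))"

definition mat_app :: "(nat \<Rightarrow> nat \<Rightarrow> real) \<Rightarrow> (nat \<Rightarrow> real) \<Rightarrow> nat \<Rightarrow> real" where
  "mat_app M x j = (\<Sum>k. M j k * x k)"

definition defines_operator ::
  "(nat \<Rightarrow> nat \<Rightarrow> real) \<Rightarrow> (nat \<Rightarrow> real) set \<Rightarrow> (nat \<Rightarrow> real) set \<Rightarrow> bool" where
  "defines_operator M E F \<longleftrightarrow>
     (\<forall>x\<in>E. (\<forall>j. summable (\<lambda>k. M j k * x k)) \<and> mat_app M x \<in> F)"

definition mat_norm ::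
  "(nat \<Rightarrow> real) set \<Rightarrow> ((nat \<Rightarrow> real) \<Rightarrow> real) \<Rightarrow> ((nat \<Rightarrow> real) \<Rightarrow> real)
     \<Rightarrow> (nat \<Rightarrow> nat \<Rightarrow> real) \<Rightarrow> ennreal" where
  "mat_norm E nE nF M = (SUP x\<in>{x\<in>E. nE x = 1}. ennreal (nF (mat_app M x)))"

definition mat_norm_decr ::
  "(nat \<Rightarrow> real) set \<Rightarrow> ((nat \<Rightarrow> real) \<Rightarrow> real) \<Rightarrow> ((nat \<Rightarrow> real) \<Rightarrow> real)
     \<Rightarrow> (nat \<Rightarrow> nat \<Rightarrow> real) \<Rightarrow> ennreal" where
  "mat_norm_decr E nE nF M =
     (SUP x\<in>{x\<in>E. nE x = 1 \<and> (\<forall>k. 0 \<le> x k) \<and> decseq x}. ennreal (nF (mat_app M x)))"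

text \<open>
  The variants below are for nonnegative matrices and sequences only, since
  \<^const>\<open>ennreal\<close> sends negative reals to 0.
\<close>

definition ext_mat_app :: "(nat \<Rightarrow> nat \<Rightarrow> real) \<Rightarrow> (nat \<Rightarrow> real) \<Rightarrow> nat \<Rightarrow> ennreal" where
  "ext_mat_app M x j = (\<Sum>k. ennreal (M j k * x k))"

text \<open>Used only for exponents \<open>p > 0\<close>.\<close>

definition ennreal_powr :: "ennreal \<Rightarrow> real \<Rightarrow> ennreal" where
  "ennreal_powr y p = (if y = top then top else ennreal (enn2real y powr p))"

definition lp_norm :: "real \<Rightarrow> (nat \<Rightarrow> real) \<Rightarrow> (nat \<Rightarrow> ennreal) \<Rightarrow> ennreal" where
  "lp_norm p v y = ennreal_powr (\<Sum>k. ennreal_powr (y k) p * ennreal (v k)) (1 / p)"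

definition mat_norm_lp ::
  "(nat \<Rightarrow> real) set \<Rightarrow> ((nat \<Rightarrow> real) \<Rightarrow> real) \<Rightarrow> real \<Rightarrow> (nat \<Rightarrow> real)
     \<Rightarrow> (nat \<Rightarrow> nat \<Rightarrow> real) \<Rightarrow> ennreal" where
  "mat_norm_lp E nE p v M =
     (SUP x\<in>{x\<in>E. nE x = 1 \<and> (\<forall>k. 0 \<le> x k)}. lp_norm p v (ext_mat_app M x))"

definition mat_norm_lp_decr ::
  "(nat \<Rightarrow> real) set \<Rightarrow> ((nat \<Rightarrow> real) \<Rightarrow> real) \<Rightarrow> real \<Rightarrow> (nat \<Rightarrow> real)
     \<Rightarrow> (nat \<Rightarrow> nat \<Rightarrow> real) \<Rightarrow> ennreal" where
  "mat_norm_lp_decr E nE p v M =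
     (SUP x\<in>{x\<in>E. nE x = 1 \<and> (\<forall>k. 0 \<le> x k) \<and> decseq x}. lp_norm p v (ext_mat_app M x))"

end

theory Submission
  imports Defs
begin

text \<open>
  Summation by parts against a sorted enumeration of a finite piece of \<open>x\<close> turns the hypothesis
  on corner sums into \<open>(\<Sum>j\<in>J. (Mx) j) \<le> (\<Sum>j<card J. (Mx\<^sup>*) j)\<close> for every finite \<open>J\<close>; the
  hypothesis is symmetric under transposition. The supremum of the left-hand sides over
  \<open>card J = n\<close> is the \<open>n\<close>-th partial sum of \<open>(Mx)\<^sup>*\<close>, so (a) is property (PS) of \<open>F\<close>. For (b),
  with \<open>y'\<close> the decreasing arrangement of an initial piece of \<open>y = Mx\<close> and \<open>z = Mx\<^sup>*\<close>, the tangent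
  inequality \<open>z\<^sup>p \<ge> y'\<^sup>p + p y'\<^sup>p\<^sup>-\<^sup>1 (z - y')\<close> reduces the claim to summation by parts against the
  decreasing weights \<open>v y'\<^sup>p\<^sup>-\<^sup>1\<close>.
\<close>

section \<open>Sorted enumerations and summation by parts\<close>

lemma obtain_antimono_enumeration:
  fixes f :: "'a \<Rightarrow> 'b::linorder"
  assumes "finite S"
  obtains \<pi> where "bij_betw \<pi> {..<card S} S"
    and "\<And>i j. i \<le> j \<Longrightarrow> j < card S \<Longrightarrow> f (\<pi> j) \<le> f (\<pi> i)"
proof -
  have "\<exists>\<pi>. bij_betw \<pi> {..<card S} S \<and> (\<forall>i j. i \<le> j \<longrightarrow> j < card S \<longrightarrow> f (\<pi> j) \<le> f (\<pi> i))"
    using assms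
  proof (induction "card S" arbitrary: S)
    case 0
    then show ?case by (auto simp: bij_betw_def)
  next
    case (Suc n)
    then have "S \<noteq> {}" by auto
    \<comment> \<open>A minimiser \<open>a\<close> of \<open>f\<close> is split off and placed last,
      after an enumeration of the rest.\<close>
    with Suc.prems obtain a where a: "a \<in> S" "\<And>s. s \<in> S \<Longrightarrow> f a \<le> f s"
      using ex_min_if_finite[of "f ` S"] by (metis finite_imageI image_iff image_is_empty not_less)
    have n: "card (S - {a}) = n" using Suc a by (simp add: card_Diff_singleton)
    obtain \<pi> where \<pi>: "bij_betw \<pi> {..<n} (S - {a})"
      "\<And>i j. i \<le> j \<Longrightarrow> j < n \<Longrightarrow> f (\<pi> j) \<le> f (\<pi> i)"
      using Suc.hyps(1)[of "S - {a}"] n Suc.prems by auto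
    have "bij_betw (\<pi>(n := a)) {..<n} (S - {a})"
      using \<pi>(1) by (subst bij_betw_cong[of _ _ \<pi>]) auto
    then have "bij_betw (\<pi>(n := a)) ({..<n} \<union> {n}) ((S - {a}) \<union> {(\<pi>(n := a)) n})"
      by (intro notIn_Un_bij_betw) auto
    then have "bij_betw (\<pi>(n := a)) {..<Suc n} S"
      using a(1) by (simp add: lessThan_Suc insert_absorb)
    moreover have "f ((\<pi>(n := a)) j) \<le> f ((\<pi>(n := a)) i)" if "i \<le> j" "j < Suc n" for i j
    proof (cases "j = n")
      case True
      moreover have "(\<pi>(n := a)) i \<in> S"
        using bij_betwE[OF \<pi>(1)] that a(1) by auto
      ultimately show ?thesis using a(2) by auto
    next
      case False
      then show ?thesis using \<pi>(2) that by auto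
    qed
    ultimately show ?case using Suc.hyps(2) by metis
  qed
  then show ?thesis using that by blast
qed

text \<open>Abel summation: with E r the r-th partial sum of d - c, the sum of (d i - c i) * y i
  equals y (n-1) * E n plus the sum over i < n-1 of (y i - y (i+1)) * E (i+1), and every term is
  nonnegative.\<close>

lemma sum_mult_le_sum_mult_antimono:
  fixes c d y :: "nat \<Rightarrow> real"
  assumes le: "\<And>r. r \<le> n \<Longrightarrow> (\<Sum>i<r. c i) \<le> (\<Sum>i<r. d i)"
    and nonneg: "\<And>i. i < n \<Longrightarrow> 0 \<le> y i"
    and anti: "\<And>i j. i \<le> j \<Longrightarrow> j < n \<Longrightarrow> y j \<le> y i"
  shows "(\<Sum>i<n. c i * y i) \<le> (\<Sum>i<n. d i * y i)"
proof -
  define e where "e i = d i - c i" for i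
  have e: "0 \<le> (\<Sum>i<r. e i)" if "r \<le> n" for r
    using le[OF that] by (simp add: e_def sum_subtractf)
  \<comment> \<open>Inductive form of the Abel identity: the nonnegative differences are dropped and
    only the boundary term is kept.\<close>
  have *: "y m * (\<Sum>i<Suc m. e i) \<le> (\<Sum>i<Suc m. e i * y i)" if "m < n" for m
    using that
  proof (induction m)
    case 0
    then show ?case by simp
  next
    case (Suc m)
    have "y (Suc m) * (\<Sum>i<Suc m. e i) \<le> y m * (\<Sum>i<Suc m. e i)"
      using Suc.prems by (intro mult_right_mono anti e) auto
    with Suc show ?case by (simp add: algebra_simps)
  qed
  have "0 \<le> (\<Sum>i<n. e i * y i)"
  proof (cases n)
    case (Suc m)
    have "0 \<le> y m * (\<Sum>i<Suc m. e i)"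
      using Suc by (intro mult_nonneg_nonneg nonneg e) auto
    also have "\<dots> \<le> (\<Sum>i<n. e i * y i)" using * Suc by simp
    finally show ?thesis .
  qed simp
  then show ?thesis by (simp add: e_def left_diff_distrib sum_subtractf)
qed

section \<open>Decreasing rearrangements and their partial sums\<close>

lemma has_rearrD:
  assumes "has_rearr x"
  shows "rearr x n \<in> min_values x (Suc n)"
    and "\<And>N. finite N \<Longrightarrow> card N = Suc n \<Longrightarrow> Min ((\<lambda>k. \<bar>x k\<bar>) ` N) \<le> rearr x n"
proof -
  obtain m where m: "m \<in> min_values x (Suc n)" "\<And>t. t \<in> min_values x (Suc n) \<Longrightarrow> t \<le> m"
    using assms unfolding has_rearr_def by fastforce
  then have eq: "rearr x n = m"
    unfolding rearr_def by (intro Greatest_equality) auto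
  show "rearr x n \<in> min_values x (Suc n)" using eq m by simp
  show "Min ((\<lambda>k. \<bar>x k\<bar>) ` N) \<le> rearr x n" if "finite N" "card N = Suc n" for N
    unfolding eq using that by (intro m(2)) (auto simp: min_values_def)
qed

text \<open>Together with \<open>rearr_ge\<close> this characterises \<open>rearr x n\<close> as the
  largest t such that t \<le> |x k| for some n + 1 indices k. Later arguments use this form in place
  of \<open>Min\<close>.\<close>

lemma rearr_attained:
  assumes "has_rearr x"
  obtains N where "finite N" "card N = Suc n" "\<And>k. k \<in> N \<Longrightarrow> rearr x n \<le> \<bar>x k\<bar>"
proof -
  obtain N where "finite N" "card N = Suc n" "rearr x n = Min ((\<lambda>k. \<bar>x k\<bar>) ` N)"
    using has_rearrD(1)[OF assms, of n] by (auto simp: min_values_def)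
  then show ?thesis by (intro that[of N]) auto
qed

lemma rearr_ge:
  assumes "has_rearr x" "finite N" "card N = Suc n" "\<And>k. k \<in> N \<Longrightarrow> t \<le> \<bar>x k\<bar>"
  shows "t \<le> rearr x n"
proof -
  have "N \<noteq> {}" using assms by auto
  then have "t \<le> Min ((\<lambda>k. \<bar>x k\<bar>) ` N)" using assms by (subst Min_ge_iff) auto
  also have "\<dots> \<le> rearr x n" using has_rearrD(2) assms by blast
  finally show ?thesis .
qed

lemma rearr_nonneg: "has_rearr x \<Longrightarrow> 0 \<le> rearr x n"
  by (rule rearr_ge[where N = "{..n}"]) auto

lemma decseq_rearr:
  assumes "has_rearr x"
  shows "decseq (rearr x)"
proof (rule decseq_SucI)
  fix n
  obtain N where N: "finite N" "card N = Suc (Suc n)" "\<And>k. k \<in> N \<Longrightarrow> rearr x (Suc n) \<le> \<bar>x k\<bar>"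
    using rearr_attained[OF assms] by metis
  then obtain a where "a \<in> N" by fastforce
  with N show "rearr x (Suc n) \<le> rearr x n"
    by (intro rearr_ge[OF assms, of "N - {a}"]) auto
qed

text \<open>The i + 1 indices \<open>\<pi> 0\<close>, ..., \<open>\<pi> i\<close> all carry values
  at least \<open>\<bar>x (\<pi> i)\<bar>\<close>.\<close>

lemma antimono_enumeration_le_rearr:
  assumes "has_rearr x" "bij_betw \<pi> {..<n} S"
    and "\<And>i j. i \<le> j \<Longrightarrow> j < n \<Longrightarrow> \<bar>x (\<pi> j)\<bar> \<le> \<bar>x (\<pi> i)\<bar>" "i < n"
  shows "\<bar>x (\<pi> i)\<bar> \<le> rearr x i"
proof (rule rearr_ge[OF assms(1), of "\<pi> ` {..i}"])
  have "inj_on \<pi> {..i}"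
    using assms(2,4) by (auto simp: bij_betw_def intro: inj_on_subset)
  then show "card (\<pi> ` {..i}) = Suc i" by (simp add: card_image)
qed (use assms in auto)

text \<open>Enumerate S so that |x| decreases. Initial segments of the enumeration are subsets of S,
  so \<open>le\<close> compares the partial sums of c and d, and summation by parts replaces c by d.
  As d is nonnegative, |x| can then be raised termwise to its rearrangement.\<close>

lemma sum_mult_le_sum_mult_rearr:
  fixes c d x :: "nat \<Rightarrow> real"
  assumes x: "has_rearr x" and S: "finite S"
    and le: "\<And>K. finite K \<Longrightarrow> K \<subseteq> S \<Longrightarrow> sum c K \<le> sum d {..<card K}"
    and d: "\<And>k. 0 \<le> d k"
  shows "(\<Sum>k\<in>S. c k * \<bar>x k\<bar>) \<le> (\<Sum>i<card S. d i * rearr x i)"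
proof -
  obtain \<pi> where \<pi>: "bij_betw \<pi> {..<card S} S"
    "\<And>i j. i \<le> j \<Longrightarrow> j < card S \<Longrightarrow> \<bar>x (\<pi> j)\<bar> \<le> \<bar>x (\<pi> i)\<bar>"
    using obtain_antimono_enumeration[OF S, of "\<lambda>k. \<bar>x k\<bar>"] by blast
  have "(\<Sum>k\<in>S. c k * \<bar>x k\<bar>) = (\<Sum>i<card S. c (\<pi> i) * \<bar>x (\<pi> i)\<bar>)"
    by (rule sum.reindex_bij_betw[OF \<pi>(1), symmetric])
  also have "\<dots> \<le> (\<Sum>i<card S. d i * \<bar>x (\<pi> i)\<bar>)"
  proof (rule sum_mult_le_sum_mult_antimono)
    fix r assume r: "r \<le> card S"
    then have inj: "inj_on \<pi> {..<r}" and sub: "\<pi> ` {..<r} \<subseteq> S"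
      using \<pi>(1) by (auto simp: bij_betw_def intro: inj_on_subset)
    have "(\<Sum>i<r. c (\<pi> i)) = sum c (\<pi> ` {..<r})"
      using inj by (simp add: sum.reindex)
    also have "\<dots> \<le> sum d {..<r}"
      using le[OF _ sub] inj by (simp add: card_image)
    finally show "(\<Sum>i<r. c (\<pi> i)) \<le> (\<Sum>i<r. d i)" .
  qed (use \<pi>(2) in auto)
  also have "\<dots> \<le> (\<Sum>i<card S. d i * rearr x i)"
    by (intro sum_mono mult_left_mono d antimono_enumeration_le_rearr[OF x \<pi>]) auto
  finally show ?thesis .
qed

lemma sum_abs_le_sum_rearr:
  assumes "has_rearr x" "finite S"
  shows "(\<Sum>k\<in>S. \<bar>x k\<bar>) \<le> (\<Sum>i<card S. rearr x i)"
  using sum_mult_le_sum_mult_rearr[OF assms, of "\<lambda>_. 1" "\<lambda>_. 1"] by simp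

lemma sum_rearr_attained:
  assumes "has_rearr x"
  shows "\<exists>N. finite N \<and> card N = n \<and> (\<Sum>i<n. rearr x i) \<le> (\<Sum>k\<in>N. \<bar>x k\<bar>)"
proof (induction n)
  case 0
  then show ?case by (intro exI[of _ "{}"]) simp
next
  case (Suc n)
  then obtain N where N: "finite N" "card N = n" "(\<Sum>i<n. rearr x i) \<le> (\<Sum>k\<in>N. \<bar>x k\<bar>)"
    by blast
  obtain N' where N': "finite N'" "card N' = Suc n" "\<And>k. k \<in> N' \<Longrightarrow> rearr x n \<le> \<bar>x k\<bar>"
    using rearr_attained[OF assms] by metis
  \<comment> \<open>The sets attaining successive values of \<open>rearr x\<close> need not be
    nested. Since N' has one element more than N, it still supplies a new index whose value is at
    least \<open>rearr x n\<close>.\<close>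
  have "\<not> N' \<subseteq> N" using N N' card_mono[of N N'] by auto
  then obtain k where "k \<in> N'" "k \<notin> N" by blast
  with N N' show ?case by (intro exI[of _ "insert k N"]) (auto simp: add.commute intro: add_mono)
qed

lemma decseq_rearr_eq:
  assumes dec: "decseq y" and nonneg: "\<And>k. 0 \<le> y k"
  shows has_rearr_decseq: "has_rearr y" and rearr_decseq: "rearr y = y"
proof -
  have mem: "y n \<in> min_values y (Suc n)" for n
  proof -
    have "Min ((\<lambda>k. \<bar>y k\<bar>) ` {..n}) = y n"
      using dec nonneg by (intro Min_eqI) (auto simp: decseq_def)
    then show ?thesis
      unfolding min_values_def by (intro CollectI exI[of _ "{..n}"]) auto
  qed
  have ub: "t \<le> y n" if t: "t \<in> min_values y (Suc n)" for t n
  proof -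
    obtain N where N: "finite N" "card N = Suc n" "t = Min ((\<lambda>k. \<bar>y k\<bar>) ` N)"
      using t by (auto simp: min_values_def)
    \<comment> \<open>Any n + 1 indices include some k \<ge> n, and there the decreasing sequence is
      at most \<open>y n\<close>.\<close>
    have "\<not> N \<subseteq> {..<n}" using N card_mono[of "{..<n}" N] by auto
    then obtain k where k: "k \<in> N" "n \<le> k" by force
    have "t \<le> \<bar>y k\<bar>" using N k by auto
    also have "\<dots> \<le> y n" using dec nonneg k by (auto simp: decseq_def)
    finally show ?thesis .
  qed
  show "has_rearr y" unfolding has_rearr_def
  proof (intro allI impI)
    fix n :: nat assume "1 \<le> n"
    then obtain m where "n = Suc m" by (cases n) auto
    then show "\<exists>m\<in>min_values y n. \<forall>t\<in>min_values y n. t \<le> m" using mem ub by blast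
  qed
  show "rearr y = y"
    unfolding rearr_def by (intro ext Greatest_equality mem ub)
qed

section \<open>Consequences of property (PS)\<close>

lemma property_PS_has_rearr: "property_PS E nE \<Longrightarrow> x \<in> E \<Longrightarrow> has_rearr x"
  by (simp add: property_PS_def)

lemma property_PS_norm_mono:
  assumes "property_PS E nE" "x \<in> E" "has_rearr y"
    and "\<And>n. (\<Sum>i<n. rearr y i) \<le> (\<Sum>i<n. rearr x i)"
  shows "y \<in> E" "nE y \<le> nE x"
  using bspec[OF assms(1)[unfolded property_PS_def] assms(2), THEN conjunct2, THEN spec[of _ y]]
    assms(3,4) by simp_all

text \<open>The rearrangement is its own rearrangement, so x and \<open>rearr x\<close> have equal
  partial sums and (PS) applies in both directions.\<close>

lemma property_PS_rearr:
  assumes "property_PS E nE" "x \<in> E"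
  shows "rearr x \<in> E" "nE (rearr x) = nE x"
proof -
  note x = property_PS_has_rearr[OF assms]
  note r = decseq_rearr_eq[OF decseq_rearr[OF x] rearr_nonneg[OF x]]
  show rx: "rearr x \<in> E"
    by (rule property_PS_norm_mono(1)[OF assms r(1)]) (simp add: r(2))
  show "nE (rearr x) = nE x"
  proof (rule antisym)
    show "nE (rearr x) \<le> nE x"
      by (rule property_PS_norm_mono(2)[OF assms r(1)]) (simp add: r(2))
    show "nE x \<le> nE (rearr x)"
      by (rule property_PS_norm_mono(2)[OF assms(1) rx x]) (simp add: r(2))
  qed
qed

section \<open>From corner sums to sums of entries of Mx\<close>

definition corner_maximal :: "(nat \<Rightarrow> nat \<Rightarrow> real) \<Rightarrow> bool" where
  "corner_maximal M \<longleftrightarrow> (\<forall>J K. finite J \<longrightarrow> finite K \<longrightarrow>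
     (\<Sum>j\<in>J. \<Sum>k\<in>K. M j k) \<le> (\<Sum>j<card J. \<Sum>k<card K. M j k))"

text \<open>Summing over j first turns each side into a series in k whose coefficients are column
  sums over J or over the first \<open>card J\<close> rows. Corner maximality compares sums of these
  coefficients, which gives the bound for partial sums in k; then n tends to infinity. Values in
  \<open>ennreal\<close> let the same bound serve divergent series in (b) and convergent ones in
  (a).\<close>

lemma sum_ext_mat_app_le_rearr:
  assumes M: "corner_maximal M" "\<And>j k. 0 \<le> M j k"
    and x: "has_rearr x" "\<And>k. 0 \<le> x k" and J: "finite J"
  shows "(\<Sum>j\<in>J. ext_mat_app M x j) \<le> (\<Sum>j<card J. ext_mat_app M (rearr x) j)"
proof -
  have swap: "(\<Sum>j\<in>I. ext_mat_app M y j) = (\<Sum>k. ennreal ((\<Sum>j\<in>I. M j k) * y k))"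
    if "\<And>k. 0 \<le> y k" "finite I" for y I
    unfolding ext_mat_app_def
    by (subst suminf_sum[symmetric]) (auto simp: that M(2) sum_distrib_right)
  have fin: "(\<Sum>k<n. ennreal ((\<Sum>j\<in>J. M j k) * x k))
      \<le> (\<Sum>k<n. ennreal ((\<Sum>j<card J. M j k) * rearr x k))" for n
  proof -
    have "(\<Sum>k<n. (\<Sum>j\<in>J. M j k) * \<bar>x k\<bar>) \<le> (\<Sum>k<card {..<n}. (\<Sum>j<card J. M j k) * rearr x k)"
    proof (rule sum_mult_le_sum_mult_rearr[OF x(1)])
      fix K :: "nat set" assume "finite K"
      then show "(\<Sum>k\<in>K. \<Sum>j\<in>J. M j k) \<le> (\<Sum>k<card K. \<Sum>j<card J. M j k)"
        using M(1) J by (subst (1 2) sum.swap) (simp add: corner_maximal_def)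
    qed (auto intro: sum_nonneg M)
    then show ?thesis
      by (subst (1 2) sum_ennreal) (auto intro!: mult_nonneg_nonneg sum_nonneg ennreal_leI simp: M x rearr_nonneg)
  qed
  show ?thesis
    by (simp add: swap J x rearr_nonneg) (intro suminf_le_const order_trans[OF fin] sum_le_suminf summableI; simp)
qed

section \<open>Weighted p-norms under majorization\<close>

lemma powr_tangent_le:
  fixes y z p :: real
  assumes "1 \<le> p" "0 \<le> y" "0 \<le> z"
  shows "y powr p + p * y powr (p - 1) * (z - y) \<le> z powr p"
proof (cases "y = 0 \<or> z = 0")
  case False
  then have "p * y powr (p - 1) * (z - y) \<le> z powr p - y powr p"
    using assms
    by (intro convex_on_imp_above_tangent[OF powr_convex[OF assms(1)]])
      (auto simp: interior_open intro!: derivative_eq_intros)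
  then show ?thesis by simp
next
  case True
  \<comment> \<open>For z = 0 the claim is that (1 - p) times the p-th power of y is at most 0. For
    y = 0 the left-hand side vanishes, also when p = 1, because \<open>0 powr 0 = 0\<close>.\<close>
  moreover have "y powr p \<le> p * (y * y powr (p - 1))"
    using assms by (simp add: powr_mult_base mult_right_mono[of 1 p, simplified])
  ultimately show ?thesis using assms by (auto simp: algebra_simps)
qed

lemma sum_powr_mult_le:
  fixes y z v :: "nat \<Rightarrow> real"
  assumes p: "1 \<le> p" and v: "decseq v" "\<And>k. 0 \<le> v k"
    and y: "\<And>j. j < n \<Longrightarrow> 0 \<le> y j" and z: "\<And>j. j < n \<Longrightarrow> 0 \<le> z j"
    and le: "\<And>J. J \<subseteq> {..<n} \<Longrightarrow> sum y J \<le> sum z {..<card J}"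
  shows "(\<Sum>j<n. y j powr p * v j) \<le> (\<Sum>j<n. z j powr p * v j)"
proof -
  obtain \<pi> where "bij_betw \<pi> {..<card {..<n}} {..<n}"
    "\<And>i j. i \<le> j \<Longrightarrow> j < card {..<n} \<Longrightarrow> y (\<pi> j) \<le> y (\<pi> i)"
    using obtain_antimono_enumeration[of "{..<n}" y] by blast
  then have \<pi>: "bij_betw \<pi> {..<n} {..<n}" "\<And>i j. i \<le> j \<Longrightarrow> j < n \<Longrightarrow> y (\<pi> j) \<le> y (\<pi> i)"
    by simp_all
  have y\<pi>: "0 \<le> y (\<pi> i)" if "i < n" for i
    using bij_betwE[OF \<pi>(1)] that y by auto
  have inj: "inj_on \<pi> {..<r}" and sub: "\<pi> ` {..<r} \<subseteq> {..<n}" if "r \<le> n" for r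
    using \<pi>(1) that by (auto simp: bij_betw_def intro: inj_on_subset)
  have "(\<Sum>j<n. y j powr p * v j) = (\<Sum>i<n. y (\<pi> i) powr p * v (\<pi> i))"
    by (rule sum.reindex_bij_betw[OF \<pi>(1), symmetric])
  also have "\<dots> = (\<Sum>i<n. v (\<pi> i) * y (\<pi> i) powr p)" by (simp add: mult.commute)
  \<comment> \<open>Rearrangement inequality: the sum grows when the sorted values of y meet the
    weights in decreasing order, since the first r weights have the largest sum among r
    weights.\<close>
  also have "\<dots> \<le> (\<Sum>i<n. v i * y (\<pi> i) powr p)"
  proof (rule sum_mult_le_sum_mult_antimono)
    fix r assume "r \<le> n"
    have "(\<Sum>i<r. v (\<pi> i)) = (\<Sum>k\<in>\<pi> ` {..<r}. \<bar>v k\<bar>)"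
      using inj[OF \<open>r \<le> n\<close>] v by (simp add: sum.reindex)
    also have "\<dots> \<le> (\<Sum>i<r. v i)"
      using sum_abs_le_sum_rearr[OF has_rearr_decseq[OF v], of "\<pi> ` {..<r}"] inj[OF \<open>r \<le> n\<close>]
      by (simp add: rearr_decseq v card_image)
    finally show "(\<Sum>i<r. v (\<pi> i)) \<le> (\<Sum>i<r. v i)" .
  qed (use p y\<pi> \<pi>(2) in \<open>auto intro!: powr_mono2\<close>)
  also have "\<dots> \<le> (\<Sum>i<n. z i powr p * v i)"
  proof -
    define w where "w i = v i * y (\<pi> i) powr (p - 1)" for i
    have "(\<Sum>i<n. y (\<pi> i) * w i) \<le> (\<Sum>i<n. z i * w i)"
    proof (rule sum_mult_le_sum_mult_antimono)
      fix r assume "r \<le> n"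
      then show "(\<Sum>i<r. y (\<pi> i)) \<le> (\<Sum>i<r. z i)"
        using le[OF sub, of r] inj[of r] by (simp add: card_image sum.reindex)
    next
      \<comment> \<open>Both factors of w are nonnegative and decreasing. For p = 1 the second is
        the indicator of \<open>y (\<pi> i) \<noteq> 0\<close>, which is decreasing as well.\<close>
      fix i j assume "i \<le> j" "j < n"
      then show "w j \<le> w i" unfolding w_def
        using v p y\<pi> \<pi>(2) by (intro mult_mono powr_mono2) (auto simp: decseq_def)
    qed (use v in \<open>auto simp: w_def\<close>)
    then have "0 \<le> p * (\<Sum>i<n. w i * (z i - y (\<pi> i)))"
      using p by (simp add: algebra_simps sum_subtractf)
    \<comment> \<open>Termwise tangent inequality at \<open>y (\<pi> i)\<close>, multiplied by
      \<open>v i\<close>.\<close>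
    also have "\<dots> \<le> (\<Sum>i<n. v i * (z i powr p - y (\<pi> i) powr p))"
      unfolding sum_distrib_left
    proof (rule sum_mono)
      fix i assume "i \<in> {..<n}"
      then have "v i * (p * y (\<pi> i) powr (p - 1) * (z i - y (\<pi> i))) \<le> v i * (z i powr p - y (\<pi> i) powr p)"
        using powr_tangent_le[OF p y\<pi> z, of i i] v by (intro mult_left_mono) auto
      then show "p * (w i * (z i - y (\<pi> i))) \<le> v i * (z i powr p - y (\<pi> i) powr p)"
        by (simp add: w_def mult_ac)
    qed
    finally show ?thesis by (simp add: algebra_simps sum_subtractf)
  qed
  finally show ?thesis .
qed

lemma ennreal_powr_mono:
  assumes "y \<le> z" "0 \<le> a"
  shows "ennreal_powr y a \<le> ennreal_powr z a"
proof (cases "z = top")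
  case False
  with assms have "y \<noteq> top" "enn2real y \<le> enn2real z"
    by (auto simp: top_unique less_top intro: enn2real_mono)
  with False assms show ?thesis
    by (auto simp: ennreal_powr_def intro!: ennreal_leI powr_mono2)
qed (simp add: ennreal_powr_def)

lemma ennreal_powr_ennreal: "0 \<le> a \<Longrightarrow> ennreal_powr (ennreal a) p = ennreal (a powr p)"
  by (simp add: ennreal_powr_def)

lemma lp_norm_mono_majorized:
  assumes p: "1 \<le> p" and v: "decseq v" "\<And>k. 0 \<le> v k"
    and le: "\<And>J. finite J \<Longrightarrow> sum y J \<le> sum z {..<card J}"
  shows "lp_norm p v y \<le> lp_norm p v z"
proof -
  have fin: "(\<Sum>j<n. ennreal_powr (y j) p * ennreal (v j)) \<le> (\<Sum>j<n. ennreal_powr (z j) p * ennreal (v j))" for n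
  proof (induction n)
    case (Suc n)
    \<comment> \<open>If \<open>v n = 0\<close>, the last term is 0 even at infinite entries and the
      induction hypothesis suffices. Otherwise all weights up to n are positive: an infinite
      \<open>z j\<close> makes the right-hand side infinite, and if there is none, every
      \<open>y j\<close> is finite, being at most \<open>z 0\<close>, so the real inequality applies
      to all n + 1 terms at once.\<close>
    consider "v n = 0" | j where "v n > 0" "j \<le> n" "z j = top" | "v n > 0" "\<And>j. j \<le> n \<Longrightarrow> z j \<noteq> top"
      using v(2)[of n] by fastforce
    then show ?case
    proof cases
      case 1
      with Suc show ?thesis by simp
    next
      case 2
      then have "v j > 0" using v(1) by (auto simp: decseq_def intro: less_le_trans)
      with 2 have "ennreal_powr (z j) p * ennreal (v j) = top"
        by (simp add: ennreal_powr_def ennreal_top_mult)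
      moreover have "ennreal_powr (z j) p * ennreal (v j) \<le> (\<Sum>j<Suc n. ennreal_powr (z j) p * ennreal (v j))"
        using 2 by (intro member_le_sum) auto
      ultimately have "(\<Sum>j<Suc n. ennreal_powr (z j) p * ennreal (v j)) = top"
        by (simp only: top_unique)
      then show ?thesis by (simp only: top_greatest)
    next
      case 3
      have y_fin: "y j \<noteq> top" for j
      proof -
        have "y j \<le> z 0" using le[of "{j}"] by simp
        with 3(2)[of 0] show ?thesis by (auto simp: top_unique)
      qed
      define Y Z where "Y j = enn2real (y j)" and "Z j = enn2real (z j)" for j
      have Y: "y j = ennreal (Y j)" "0 \<le> Y j" for j
        using y_fin by (auto simp: Y_def less_top)
      have Z: "z j = ennreal (Z j)" if "j < Suc n" for j
        using 3(2) that by (auto simp: Z_def less_top)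
      have Z0: "0 \<le> Z j" for j by (simp add: Z_def)
      have "(\<Sum>j<Suc n. Y j powr p * v j) \<le> (\<Sum>j<Suc n. Z j powr p * v j)"
      proof (rule sum_powr_mult_le[OF p v])
        fix J assume J: "J \<subseteq> {..<Suc n}"
        then have "finite J" "card J \<le> Suc n"
          using card_mono[OF _ J] finite_subset[OF J] by auto
        then have "ennreal (sum Y J) \<le> ennreal (sum Z {..<card J})"
          using le[of J] Y Z Z0 by (simp flip: sum_ennreal)
        then show "sum Y J \<le> sum Z {..<card J}"
          by (simp add: Z0 sum_nonneg)
      qed (use Y Z0 in auto)
      then have "ennreal (\<Sum>j<Suc n. Y j powr p * v j) \<le> ennreal (\<Sum>j<Suc n. Z j powr p * v j)"
        by (rule ennreal_leI)
      then show ?thesis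
        using Y Z Z0 v
        by (simp del: sum.lessThan_Suc add: ennreal_powr_ennreal flip: sum_ennreal ennreal_mult)
    qed
  qed simp
  show ?thesis
    unfolding lp_norm_def using p
    by (intro ennreal_powr_mono suminf_le_const order_trans[OF fin] sum_le_suminf summableI) auto
qed

lemma lp_norm_ext_mat_app_le_rearr:
  assumes "corner_maximal M" "\<And>j k. 0 \<le> M j k" "has_rearr x" "\<And>k. 0 \<le> x k"
    and "1 \<le> p" "decseq v" "\<And>k. 0 \<le> v k"
  shows "lp_norm p v (ext_mat_app M x) \<le> lp_norm p v (ext_mat_app M (rearr x))"
  using assms by (intro lp_norm_mono_majorized sum_ext_mat_app_le_rearr)

lemma mat_norm_lp_eq_decr:
  assumes E: "property_PS E nE"
    and le: "\<And>x. x \<in> E \<Longrightarrow> (\<And>k. 0 \<le> x k) \<Longrightarrow>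
      lp_norm p v (ext_mat_app M x) \<le> lp_norm p v (ext_mat_app M (rearr x))"
  shows "mat_norm_lp E nE p v M = mat_norm_lp_decr E nE p v M"
proof (rule antisym)
  have decr: "rearr x \<in> {x \<in> E. nE x = 1 \<and> (\<forall>k. 0 \<le> x k) \<and> decseq x}"
    if "x \<in> E" "nE x = 1" for x
    using property_PS_rearr[OF E that(1)] property_PS_has_rearr[OF E that(1)] that(2)
    by (simp add: rearr_nonneg decseq_rearr)
  show "mat_norm_lp E nE p v M \<le> mat_norm_lp_decr E nE p v M"
    unfolding mat_norm_lp_def mat_norm_lp_decr_def
    by (intro SUP_mono) (use le decr in blast)
  show "mat_norm_lp_decr E nE p v M \<le> mat_norm_lp E nE p v M"
    unfolding mat_norm_lp_def mat_norm_lp_decr_def by (intro SUP_subset_mono) auto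
qed

section \<open>Matrix operators between spaces with property (PS)\<close>

lemma ext_mat_app_eq_ennreal:
  assumes "\<And>j k. 0 \<le> M j k" "\<And>k. 0 \<le> x k" "summable (\<lambda>k. M j k * x k)"
  shows "ext_mat_app M x j = ennreal (mat_app M x j)"
  unfolding ext_mat_app_def mat_app_def using assms by (intro suminf_ennreal2) auto

lemma mat_app_nonneg:
  assumes "\<And>j k. 0 \<le> M j k" "\<And>k. 0 \<le> x k" "summable (\<lambda>k. M j k * x k)"
  shows "0 \<le> mat_app M x j"
  unfolding mat_app_def using assms by (intro suminf_nonneg) auto

lemma norm_mat_app_le_rearr:
  assumes M: "corner_maximal M" "\<And>j k. 0 \<le> M j k"
    and E: "property_PS E nE" and F: "property_PS F nF" and op: "defines_operator M E F"
    and x: "x \<in> E" "\<And>k. 0 \<le> x k"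
  shows "nF (mat_app M x) \<le> nF (mat_app M (rearr x))"
proof -
  note x_rearr = property_PS_has_rearr[OF E x(1)]
  note rx = property_PS_rearr(1)[OF E x(1)] rearr_nonneg[OF x_rearr]
  have summ: "summable (\<lambda>k. M j k * z k)" and "mat_app M z \<in> F" if "z \<in> E" for z j
    using op that by (auto simp: defines_operator_def)
  then have Mx: "has_rearr (mat_app M x)" and Mrx: "has_rearr (mat_app M (rearr x))"
    and Mrx_F: "mat_app M (rearr x) \<in> F"
    using property_PS_has_rearr[OF F] x rx by auto
  note app = ext_mat_app_eq_ennreal[OF M(2) _ summ] mat_app_nonneg[OF M(2) _ summ]
  have "(\<Sum>i<n. rearr (mat_app M x) i) \<le> (\<Sum>i<n. rearr (mat_app M (rearr x)) i)" for n
  proof -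
    obtain J where J: "finite J" "card J = n"
      "(\<Sum>i<n. rearr (mat_app M x) i) \<le> (\<Sum>j\<in>J. \<bar>mat_app M x j\<bar>)"
      using sum_rearr_attained[OF Mx] by blast
    note J(3)
    also have "(\<Sum>j\<in>J. \<bar>mat_app M x j\<bar>) = (\<Sum>j\<in>J. mat_app M x j)"
      using app x by simp
    also have "\<dots> \<le> (\<Sum>j<n. mat_app M (rearr x) j)"
    proof -
      have "ennreal (\<Sum>j\<in>J. mat_app M x j) \<le> ennreal (\<Sum>j<n. mat_app M (rearr x) j)"
        using sum_ext_mat_app_le_rearr[OF M x_rearr x(2) J(1)] app x rx J(2)
        by (simp flip: sum_ennreal)
      then show ?thesis using app rx by (simp add: sum_nonneg)
    qed
    \<comment> \<open>The first n entries are one choice of n indices, so their sum is at most the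
      n-th partial sum of the rearrangement; this is the form that (PS) of F requires.\<close>
    also have "\<dots> \<le> (\<Sum>j<n. \<bar>mat_app M (rearr x) j\<bar>)" by (intro sum_mono) simp
    also have "\<dots> \<le> (\<Sum>i<n. rearr (mat_app M (rearr x)) i)"
      using sum_abs_le_sum_rearr[OF Mrx, of "{..<n}"] by simp
    finally show ?thesis .
  qed
  then show ?thesis by (rule property_PS_norm_mono(2)[OF F Mrx_F Mx])
qed

text \<open>Membership comes from the lattice operations, |x| being the supremum of x and -x; the
  norms agree by monotonicity in both directions.\<close>

lemma normed_riesz_seq_space_abs:
  assumes "normed_riesz_seq_space E nE" "x \<in> E"
  shows "(\<lambda>k. \<bar>x k\<bar>) \<in> E" "nE (\<lambda>k. \<bar>x k\<bar>) = nE x"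
proof -
  have "(\<lambda>k. -1 * x k) \<in> E" using assms unfolding normed_riesz_seq_space_def by blast
  then have "sup x (\<lambda>k. -1 * x k) \<in> E"
    using assms unfolding normed_riesz_seq_space_def by blast
  moreover have "sup x (\<lambda>k. -1 * x k) = (\<lambda>k. \<bar>x k\<bar>)"
    by (auto simp: fun_eq_iff sup_real_def)
  ultimately show abs: "(\<lambda>k. \<bar>x k\<bar>) \<in> E" by simp
  have mono: "nE y \<le> nE z" if "y \<in> E" "z \<in> E" "\<And>k. \<bar>y k\<bar> \<le> \<bar>z k\<bar>" for y z
    using assms(1) that unfolding normed_riesz_seq_space_def by blast
  show "nE (\<lambda>k. \<bar>x k\<bar>) = nE x"
    by (intro antisym mono abs assms) auto
qed

text \<open>As M is nonnegative, convergence of M|x| is absolute convergence of Mx, whence |Mx|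
  \<le> M|x| coordinatewise.\<close>

lemma norm_mat_app_le_abs:
  assumes M: "\<And>j k. 0 \<le> M j k"
    and E: "normed_riesz_seq_space E nE" and F: "normed_riesz_seq_space F nF"
    and op: "defines_operator M E F" and x: "x \<in> E"
  shows "nF (mat_app M x) \<le> nF (mat_app M (\<lambda>k. \<bar>x k\<bar>))"
proof -
  note abs = normed_riesz_seq_space_abs(1)[OF E x]
  have "\<bar>mat_app M x j\<bar> \<le> \<bar>mat_app M (\<lambda>k. \<bar>x k\<bar>) j\<bar>" for j
  proof -
    have "summable (\<lambda>k. \<bar>M j k * x k\<bar>)"
      using op abs M by (simp add: defines_operator_def abs_mult)
    then have "\<bar>mat_app M x j\<bar> \<le> (\<Sum>k. \<bar>M j k * x k\<bar>)"
      unfolding mat_app_def by (rule summable_rabs)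
    then show ?thesis using M by (simp add: mat_app_def abs_mult)
  qed
  with F op x abs show ?thesis
    unfolding normed_riesz_seq_space_def defines_operator_def by blast
qed

text \<open>The full norm admits x of any sign, so x is replaced first by |x| and then by the
  rearrangement of |x|. Neither step changes the norm in E or lowers the norm of the image.\<close>

lemma mat_norm_eq_decr:
  assumes M: "\<And>j k. 0 \<le> M j k"
    and E: "normed_riesz_seq_space E nE" "property_PS E nE" and F: "normed_riesz_seq_space F nF"
    and op: "defines_operator M E F"
    and le: "\<And>x. x \<in> E \<Longrightarrow> (\<And>k. 0 \<le> x k) \<Longrightarrow> nF (mat_app M x) \<le> nF (mat_app M (rearr x))"
  shows "mat_norm E nE nF M = mat_norm_decr E nE nF M"
proof (rule antisym)
  show "mat_norm E nE nF M \<le> mat_norm_decr E nE nF M"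
    unfolding mat_norm_def mat_norm_decr_def
  proof (rule SUP_mono)
    fix x assume "x \<in> {x \<in> E. nE x = 1}"
    then have x: "x \<in> E" "nE x = 1" by auto
    note abs = normed_riesz_seq_space_abs[OF E(1) x(1)]
    let ?y = "rearr (\<lambda>k. \<bar>x k\<bar>)"
    have "?y \<in> {x \<in> E. nE x = 1 \<and> (\<forall>k. 0 \<le> x k) \<and> decseq x}"
      using property_PS_rearr[OF E(2) abs(1)] property_PS_has_rearr[OF E(2) abs(1)] abs(2) x(2)
      by (simp add: rearr_nonneg decseq_rearr)
    moreover have "nF (mat_app M x) \<le> nF (mat_app M ?y)"
      using norm_mat_app_le_abs[OF M E(1) F op x(1)] le[OF abs(1)] by simp
    ultimately show "\<exists>y\<in>{x \<in> E. nE x = 1 \<and> (\<forall>k. 0 \<le> x k) \<and> decseq x}.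
        ennreal (nF (mat_app M x)) \<le> ennreal (nF (mat_app M y))"
      by (blast intro: ennreal_leI)
  qed
  show "mat_norm_decr E nE nF M \<le> mat_norm E nE nF M"
    unfolding mat_norm_def mat_norm_decr_def by (intro SUP_subset_mono) auto
qed

theorem theorem4p1:
  fixes A M :: "nat \<Rightarrow> nat \<Rightarrow> real"
  assumes "\<And>j k. 0 \<le> A j k"
    and "\<And>l r J K. l \<ge> 1 \<Longrightarrow> r \<ge> 1 \<Longrightarrow> finite J \<Longrightarrow> card J = l \<Longrightarrow> finite K \<Longrightarrow> card K = r \<Longrightarrow>
           (\<Sum>j<l. \<Sum>k<r. A j k) \<ge> (\<Sum>j\<in>J. \<Sum>k\<in>K. A j k)"
    and "M = A \<or> M = (\<lambda>j k. A k j)"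
  shows "(\<forall>E nE F nF.
            normed_riesz_seq_space E nE \<and> property_PS E nE \<and>
            normed_riesz_seq_space F nF \<and> property_PS F nF \<and>
            (\<forall>x\<in>F. (\<lambda>n. nF (trunc n x)) \<longlonglongrightarrow> nF x) \<and>
            defines_operator M E F \<longrightarrow>
              (\<forall>x\<in>E. (\<forall>k. 0 \<le> x k) \<longrightarrow> nF (mat_app M (rearr x)) \<ge> nF (mat_app M x)) \<and>
              mat_norm E nE nF M = mat_norm_decr E nE nF M)
       \<and> (\<forall>(p::real) (v::nat \<Rightarrow> real) E nE.
            1 \<le> p \<and> decseq v \<and> (\<forall>k. 0 \<le> v k) \<and>
            normed_riesz_seq_space E nE \<and> property_PS E nE \<longrightarrow>
              (\<forall>x\<in>E. (\<forall>k. 0 \<le> x k) \<longrightarrow>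
                 lp_norm p v (ext_mat_app M (rearr x)) \<ge> lp_norm p v (ext_mat_app M x)) \<and>
              mat_norm_lp E nE p v M = mat_norm_lp_decr E nE p v M)"
proof -
  \<comment> \<open>The hypothesis covers sizes at least 1; if J or K is empty, both sides are
    0.\<close>
  have le: "(\<Sum>j\<in>J. \<Sum>k\<in>K. A j k) \<le> (\<Sum>j<card J. \<Sum>k<card K. A j k)"
    if "finite J" "finite K" for J K
    using assms(2)[of "card J" "card K" J K] that
    by (cases "J = {} \<or> K = {}") (auto simp: Suc_le_eq card_gt_0_iff)
  have "corner_maximal A"
    using le by (simp add: corner_maximal_def)
  \<comment> \<open>Transposing exchanges the roles of J and K, up to the order of
    summation.\<close>
  moreover have "corner_maximal (\<lambda>j k. A k j)"
    unfolding corner_maximal_def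
  proof (intro allI impI)
    fix J K :: "nat set" assume "finite J" "finite K"
    then show "(\<Sum>j\<in>J. \<Sum>k\<in>K. A k j) \<le> (\<Sum>j<card J. \<Sum>k<card K. A k j)"
      using le[of K J] sum.swap[of A J K] sum.swap[of A "{..<card J}" "{..<card K}"] by simp
  qed
  ultimately have M: "corner_maximal M" "\<And>j k. 0 \<le> M j k"
    using assms(1,3) by auto
  have a: "(\<forall>x\<in>E. (\<forall>k. 0 \<le> x k) \<longrightarrow> nF (mat_app M (rearr x)) \<ge> nF (mat_app M x)) \<and>
      mat_norm E nE nF M = mat_norm_decr E nE nF M"
    if "normed_riesz_seq_space E nE" "property_PS E nE" "normed_riesz_seq_space F nF"
      "property_PS F nF" "defines_operator M E F" for E nE F nF
    using norm_mat_app_le_rearr[OF M that(2,4,5)] mat_norm_eq_decr[OF M(2) that(1,2,3,5)] by blast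
  have b: "(\<forall>x\<in>E. (\<forall>k. 0 \<le> x k) \<longrightarrow>
        lp_norm p v (ext_mat_app M (rearr x)) \<ge> lp_norm p v (ext_mat_app M x)) \<and>
      mat_norm_lp E nE p v M = mat_norm_lp_decr E nE p v M"
    if "1 \<le> p" "decseq v" "\<forall>k. 0 \<le> v k" "property_PS E nE" for p v E nE
  proof -
    have "lp_norm p v (ext_mat_app M x) \<le> lp_norm p v (ext_mat_app M (rearr x))"
      if "x \<in> E" "\<And>k. 0 \<le> x k" for x
      using property_PS_has_rearr[OF \<open>property_PS E nE\<close>] that \<open>1 \<le> p\<close> \<open>decseq v\<close> \<open>\<forall>k. 0 \<le> v k\<close>
      by (intro lp_norm_ext_mat_app_le_rearr M) auto
    with mat_norm_lp_eq_decr[OF that(4)] show ?thesis by blast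
  qed
  show ?thesis
    by (rule conjI; intro allI impI; elim conjE) (rule a b; assumption)+
qed

end
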